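(* Assume that $H\in W^7_\infty(\Omega)$ with $\Omega$ an open neighborhood of $x_{j+1/2}$. For $i\in\{j,j-1\}$ let $\hat f_{i+1/2}=\hat f(x_{i+1/2})$ be the numerical flux at the cell boundary $x_{i+1/2}$ built from the exponential space spanned by $\{1,x,x^2,\sinh\lambda x,\cosh\lambda x\}$ (shifted to $x_{i+1/2}$), as defined in the context. If $H^{(4)}(x_{i+1/2})\neq 0$, $H^{(6)}(x_{i+1/2})\ne 0$, and the tension parameter $\lambda$ used at $x_{i+1/2}$ satisfies $$\lambda^2=\Big(\frac{H^{(6)}}{H^{(4)}}\Big)(x_{i+1/2})+\mathcal O(\Delta x),$$ then $$h(x_{i+1/2})-\hat f(x_{i+1/2})=C_j\,\Delta x^6+\mathcal O(\Delta x^7)\qquad(\Delta x\to 0),$$ with the same constant for $i=j$ and $i=j-1$ (i.e. at $x_{j\pm1/2}$), namely $$C_j=\Big(\frac{H^{(5)}H^{(6)}}{H^{(4)}}-H^{(7)}\Big)(x_j)\ \sum_{n=0}^{5}\bar u_n'(1/2)\,\frac{(n-3)^7}{7!},$$ where $\bar u_n$, $n=0,\dots,5$, are the Lagrange polynomials of degree $5$ on the stencil $\{-5/2,-3/2,\dots,5/2\}$.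
   Context: Grid: uniform cells $[x_{i-1/2},x_{i+1/2}]$ with centers $x_i$ and size $\Delta x=x_{i+1/2}-x_{i-1/2}$. The flux function $h$ is defined implicitly by $f(q(x))=\frac1{\Delta x}\int_{x-\Delta x/2}^{x+\Delta x/2}h(s)\,ds$, and $H$ is a primitive of $h$, so $H'=h$. $W^k_\infty(\Omega)=\{g\in C^{(k)}(\Omega):\|g^{(k)}\|_{L^\infty(\Omega)}<\infty\}$. Numerical flux at $x_{i+1/2}$: let $\lambda\in\mathbb R\cup i\mathbb R$, $\lambda\ne0$ (in this set, $i$ is the imaginary unit), and put $\varphi_n(x)=x^n/n!$ for $n=0,\dots,3$, $\varphi_4(x)=\lambda^{-4}\big(\cosh(\lambda x)-1-\tfrac{(\lambda x)^2}{2}\big)$, $\varphi_5(x)=\lambda^{-5}\big(\sinh(\lambda x)-\lambda x-\tfrac{(\lambda x)^3}{3!}\big)$; the derivatives $\varphi_n'$ span the same space as $\{1,x,x^2,\sinh\lambda x,\cosh\lambda x\}$. The Lagrange functions $L_0,\dots,L_5$ on the cell boundaries $x_{i-5/2},\dots,x_{i+5/2}$ are determined by $$\sum_{n=0}^5 L_n(x)\,\varphi_\ell(x_{i-5/2+n}-x_{i+1/2})=\varphi_\ell(x-x_{i+1/2}),\qquad \ell=0,\dots,5,$$ and $\hat f_{i+1/2}=\hat f(x_{i+1/2}):=\sum_{n=0}^{5}L_n'(x_{i+1/2})\,H(x_{i-5/2+n})$. The Lagrange functions and $\lambda$ depend on the boundary $x_{i+1/2}$. The polynomials $\bar u_n$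 have degree $5$ and satisfy $\bar u_n(-5/2+m)=\delta_{n,m}$ for $n,m=0,\dots,5$.
   Formalization: The formal theorem assumes λ² = (H⁽⁶⁾/H⁽⁴⁾)(x_{i+1/2}) + O(Δx²) instead of O(Δx), and additionally H⁽⁷⁾(x) − H⁽⁷⁾(x_{j+1/2}) = O(x − x_{j+1/2}); without either the claimed expansion is false. *)

theory Defs
  imports "HOL-Analysis.Analysis" "HOL-Computational_Algebra.Polynomial"
begin

abbreviation nth_deriv :: "nat \<Rightarrow> (real \<Rightarrow> real) \<Rightarrow> real \<Rightarrow> real" where
  "nth_deriv k g \<equiv> (deriv ^^ k) g"

(* Intended for open domains. The top derivative is continuous there, so its L-infinity norm is
   its supremum. *)
definition W_inf :: "nat \<Rightarrow> real set \<Rightarrow> (real \<Rightarrow> real) set" where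
  "W_inf k D = {g.
     (\<forall>m<k. \<forall>x\<in>D. (nth_deriv m g has_real_derivative nth_deriv (Suc m) g x) (at x)) \<and>
     continuous_on D (nth_deriv k g) \<and> bounded (nth_deriv k g ` D)}"

(* The cell boundary x_(i+1/2) of the uniform grid of size dx whose boundary x_(j+1/2) is the
   fixed point xb. An integer i always names the boundary x_(i+1/2), so x_(i-5/2+n) is the
   boundary with index i - 3 + n. *)
definition cell_boundary :: "real \<Rightarrow> int \<Rightarrow> real \<Rightarrow> int \<Rightarrow> real" where
  "cell_boundary xb j dx i = xb + of_int (i - j) * dx"

definition cell_center :: "(int \<Rightarrow> real) \<Rightarrow> int \<Rightarrow> real" where
  "cell_center X i = (X (i - 1) + X i) / 2"

(* Complex-valued because the tension parameter may be purely imaginary; for real or purely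
   imaginary lam the values are real. *)
definition expo_basis :: "complex \<Rightarrow> nat \<Rightarrow> real \<Rightarrow> complex" where
  "expo_basis lam n x =
     (if n \<le> 3 then of_real x ^ n / fact n
      else if n = 4 then (cosh (lam * of_real x) - 1 - (lam * of_real x) ^ 2 / 2) / lam ^ 4
      else (sinh (lam * of_real x) - lam * of_real x - (lam * of_real x) ^ 3 / fact 3) / lam ^ 5)"

(* A linear system for L 0 x, ..., L 5 x. For fixed grid and real or imaginary lam its matrix is
   real, and it is regular whenever |lam| * dx is small, hence L is then determined. *)
definition lagrange_functions ::
    "complex \<Rightarrow> (int \<Rightarrow> real) \<Rightarrow> int \<Rightarrow> (nat \<Rightarrow> real \<Rightarrow> real) \<Rightarrow> bool" where
  "lagrange_functions lam X i L \<longleftrightarrow>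
     (\<forall>l\<le>5. \<forall>x. (\<Sum>n\<le>5. of_real (L n x) * expo_basis lam l (X (i - 3 + int n) - X i))
                 = expo_basis lam l (x - X i))"

definition num_flux ::
    "(nat \<Rightarrow> real \<Rightarrow> real) \<Rightarrow> (int \<Rightarrow> real) \<Rightarrow> int \<Rightarrow> (real \<Rightarrow> real) \<Rightarrow> real" where
  "num_flux L X i H = (\<Sum>n\<le>5. deriv (L n) (X i) * H (X (i - 3 + int n)))"

(* This is the coefficient of dx^6 in the flux error provided that lam^2 agrees with
   H^(6) / H^(4) at the cell boundary up to O(dx^2). To leading order the error also contains
   (lam^2 H^(4) - H^(6)) dx^5 times the sum of poly (pderiv (u n)) (1/2) (n - 3)^6 / 6!, and that
   sum is -1/60, so a deviation of lam^2 of exact order dx would change the coefficient. *)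
definition leading_const :: "(real \<Rightarrow> real) \<Rightarrow> (nat \<Rightarrow> real poly) \<Rightarrow> real \<Rightarrow> real" where
  "leading_const H u x =
     (nth_deriv 5 H x * nth_deriv 6 H x / nth_deriv 4 H x - nth_deriv 7 H x) *
     (\<Sum>n\<le>5. poly (pderiv (u n)) (1/2) * (real n - 3) ^ 7 / fact 7)"

end

theory Submission
  imports Defs
begin

text \<open>
  Put $d = \Delta x$ and $w_n = d\, L_n'(x_{i+1/2})$. Differentiating the Lagrange system at
  $x_{i+1/2}$ says that the $w_n$ differentiate the basis functions exactly. After scaling, that
  system differs from the polynomial one only in the two hyperbolic rows, by $O(d^2)$. This rank two
  perturbation is inverted by hand, which shows that the $L_n$ are differentiable and that
  $w_n = \bar u_n'(1/2) + O(d^2)$.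

  With the moments $S_m = \sum_n w_n (n-3)^m / m!$, the rows $0, \dots, 3$ give
  $S_m = \delta_{m,1}$, while the expansion of $\cosh$ and $\sinh$ turns the last two rows into
  $S_4 = -\lambda^2 d^2 S_6 + O(d^4)$ and $S_5 = -\lambda^2 d^2 S_7 + O(d^4)$. Inserting this into
  the Taylor expansion of $H$, the $d^5$ term of the error is
  $(\lambda^2 H^{(4)} - H^{(6)}) S_6 d^5 = O(d^7)$, and the $d^6$ term is
  $(\lambda^2 H^{(5)} - H^{(7)}) S_7 d^6$.
\<close>

section \<open>Taylor bounds for the hyperbolic basis functions\<close>

lemma norm_exp_taylor:
  fixes z :: complex
  assumes "norm z \<le> 1"
  shows "norm (exp z - (\<Sum>k\<le>n. z ^ k / fact k)) \<le> 3 * norm z ^ Suc n / fact n"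
proof -
  have "exp \<bar>Re z\<bar> \<le> exp 1"
    using abs_Re_le_cmod[of z] assms by simp
  then have "exp \<bar>Re z\<bar> \<le> 3"
    using exp_le by linarith
  have "norm (exp z - (\<Sum>k\<le>n. z ^ k / fact k)) \<le> exp \<bar>Re z\<bar> * norm z ^ Suc n / fact n"
    by (rule Taylor_exp)
  also have "\<dots> \<le> 3 * norm z ^ Suc n / fact n"
    using \<open>exp \<bar>Re z\<bar> \<le> 3\<close> by (intro divide_right_mono mult_right_mono) auto
  finally show ?thesis .
qed

text \<open>\<open>cosh z\<close> is the mean of \<open>exp z\<close> and \<open>exp (- z)\<close>.
  Averaging their expansions up to degree 7 cancels the odd terms, and each remainder is at most
  \<open>3 * norm z ^ 8 / fact 7\<close> on the unit disc, where 3 bounds e.\<close>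

lemma norm_cosh_taylor:
  fixes z :: complex
  assumes "norm z \<le> 1"
  shows "norm (cosh z - 1 - z ^ 2 / 2 - z ^ 4 / 24 - z ^ 6 / 720) \<le> 3 * norm z ^ 8 / 5040"
proof -
  have "cosh z - 1 - z ^ 2 / 2 - z ^ 4 / 24 - z ^ 6 / 720 =
     ((exp z - (\<Sum>k\<le>7. z ^ k / fact k)) + (exp (- z) - (\<Sum>k\<le>7. (- z) ^ k / fact k))) / 2"
    by (simp add: cosh_def scaleR_conv_of_real numeral_eq_Suc field_simps)
  then have "norm (cosh z - 1 - z ^ 2 / 2 - z ^ 4 / 24 - z ^ 6 / 720) =
     norm ((exp z - (\<Sum>k\<le>7. z ^ k / fact k)) + (exp (- z) - (\<Sum>k\<le>7. (- z) ^ k / fact k))) / 2"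
    by (simp only:) (simp add: norm_divide)
  also have "\<dots> \<le> (3 * norm z ^ 8 / 5040 + 3 * norm (- z) ^ 8 / 5040) / 2"
    using norm_exp_taylor[OF assms, of 7] norm_exp_taylor[of "- z" 7] assms
    by (intro divide_right_mono norm_triangle_le add_mono) (auto simp: fact_numeral)
  finally show ?thesis by simp
qed

text \<open>The odd counterpart: in half the difference of the expansions up to degree 8 the even
  terms cancel, and 40320 = 8!.\<close>

lemma norm_sinh_taylor:
  fixes z :: complex
  assumes "norm z \<le> 1"
  shows "norm (sinh z - z - z ^ 3 / 6 - z ^ 5 / 120 - z ^ 7 / 5040) \<le> 3 * norm z ^ 9 / 40320"
proof -
  have "sinh z - z - z ^ 3 / 6 - z ^ 5 / 120 - z ^ 7 / 5040 =
     ((exp z - (\<Sum>k\<le>8. z ^ k / fact k)) - (exp (- z) - (\<Sum>k\<le>8. (- z) ^ k / fact k))) / 2"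
    by (simp add: sinh_def scaleR_conv_of_real numeral_eq_Suc field_simps)
  then have "norm (sinh z - z - z ^ 3 / 6 - z ^ 5 / 120 - z ^ 7 / 5040) =
     norm ((exp z - (\<Sum>k\<le>8. z ^ k / fact k)) - (exp (- z) - (\<Sum>k\<le>8. (- z) ^ k / fact k))) / 2"
    by (simp only:) (simp add: norm_divide)
  also have "\<dots> \<le> (3 * norm z ^ 9 / 40320 + 3 * norm (- z) ^ 9 / 40320) / 2"
    using norm_exp_taylor[OF assms, of 8] norm_exp_taylor[of "- z" 8] assms
    by (intro divide_right_mono order_trans[OF norm_triangle_ineq4 add_mono]) (auto simp: fact_numeral)
  finally show ?thesis by simp
qed

text \<open>Division by \<open>lam ^ 4\<close> turns the terms of degree 4 and 6 of cosh into a
  monomial and its first correction in \<open>lam ^ 2\<close>. The remainder of degree 8 keeps a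
  factor \<open>norm lam ^ 4\<close>, so the bound does not degenerate for small
  \<open>lam\<close>.\<close>

lemma expo_basis_4_taylor:
  assumes "lam \<noteq> 0" and "norm lam * \<bar>x\<bar> \<le> 1"
  shows "\<bar>Re (expo_basis lam 4 x) - x ^ 4 / 24 - Re (lam ^ 2) * x ^ 6 / 720\<bar>
    \<le> norm lam ^ 4 * \<bar>x\<bar> ^ 8 / 1680"
proof -
  define z where "z = lam * of_real x"
  have nz: "norm z = norm lam * \<bar>x\<bar>" by (simp add: z_def norm_mult)
  have "expo_basis lam 4 x - of_real (x ^ 4 / 24) - lam ^ 2 * of_real (x ^ 6 / 720)
      = (cosh z - 1 - z ^ 2 / 2 - z ^ 4 / 24 - z ^ 6 / 720) / lam ^ 4"
    using assms(1) by (simp add: expo_basis_def z_def field_simps)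
  then have "norm (expo_basis lam 4 x - of_real (x ^ 4 / 24) - lam ^ 2 * of_real (x ^ 6 / 720))
      = norm (cosh z - 1 - z ^ 2 / 2 - z ^ 4 / 24 - z ^ 6 / 720) / norm lam ^ 4"
    by (simp add: norm_divide norm_power)
  also have "\<dots> \<le> (3 * norm z ^ 8 / 5040) / norm lam ^ 4"
    using assms nz by (intro divide_right_mono norm_cosh_taylor) auto
  also have "\<dots> = norm lam ^ 4 * \<bar>x\<bar> ^ 8 / 1680"
    using assms(1) by (simp add: nz power_mult_distrib field_simps flip: power_add)
  finally have "\<bar>Re (expo_basis lam 4 x - of_real (x ^ 4 / 24) - lam ^ 2 * of_real (x ^ 6 / 720))\<bar>
      \<le> norm lam ^ 4 * \<bar>x\<bar> ^ 8 / 1680"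
    using abs_Re_le_cmod order_trans by blast
  then show ?thesis by (simp del: of_real_divide of_real_power)
qed

lemma expo_basis_5_taylor:
  assumes "lam \<noteq> 0" and "norm lam * \<bar>x\<bar> \<le> 1"
  shows "\<bar>Re (expo_basis lam 5 x) - x ^ 5 / 120 - Re (lam ^ 2) * x ^ 7 / 5040\<bar>
    \<le> norm lam ^ 4 * \<bar>x\<bar> ^ 9 / 13440"
proof -
  define z where "z = lam * of_real x"
  have nz: "norm z = norm lam * \<bar>x\<bar>" by (simp add: z_def norm_mult)
  have "expo_basis lam 5 x - of_real (x ^ 5 / 120) - lam ^ 2 * of_real (x ^ 7 / 5040)
      = (sinh z - z - z ^ 3 / 6 - z ^ 5 / 120 - z ^ 7 / 5040) / lam ^ 5"
    using assms(1) by (simp add: expo_basis_def z_def field_simps fact_numeral)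
  then have "norm (expo_basis lam 5 x - of_real (x ^ 5 / 120) - lam ^ 2 * of_real (x ^ 7 / 5040))
      = norm (sinh z - z - z ^ 3 / 6 - z ^ 5 / 120 - z ^ 7 / 5040) / norm lam ^ 5"
    by (simp add: norm_divide norm_power)
  also have "\<dots> \<le> (3 * norm z ^ 9 / 40320) / norm lam ^ 5"
    using assms nz by (intro divide_right_mono norm_sinh_taylor) auto
  also have "\<dots> = norm lam ^ 4 * \<bar>x\<bar> ^ 9 / 13440"
    using assms(1) by (simp add: nz power_mult_distrib field_simps flip: power_add)
  finally have "\<bar>Re (expo_basis lam 5 x - of_real (x ^ 5 / 120) - lam ^ 2 * of_real (x ^ 7 / 5040))\<bar>
      \<le> norm lam ^ 4 * \<bar>x\<bar> ^ 9 / 13440"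
    using abs_Re_le_cmod order_trans by blast
  then show ?thesis by (simp del: of_real_divide of_real_power)
qed

section \<open>Derivatives of the basis functions at the origin\<close>

lemma le_5_cases:
  fixes l :: nat
  assumes "l \<le> 5"
  obtains "l \<le> 3" | "l = 4" | "l = 5"
  using assms by linarith

text \<open>The subtracted Taylor terms make the two hyperbolic functions start at orders 4 and 5,
  so among all six only the linear one has a nonzero slope at 0. This gives the right-hand side of
  the differentiated Lagrange system.\<close>

lemma Re_expo_basis_has_derivative_0:
  assumes "lam \<noteq> 0" "l \<le> 5"
  shows "((\<lambda>x. Re (expo_basis lam l x)) has_real_derivative (if l = 1 then 1 else 0)) (at 0)"
proof -
  \<comment> \<open>The hyperbolic functions are differentiated over the complex field and then
    restricted to the real line.\<close>
  have *: "(expo_basis lam l has_vector_derivative (if l = 1 then 1 else 0)) (at 0)"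
    using assms(2)
  proof (cases rule: le_5_cases)
    case 1
    then have "l \<in> {0, 1, 2, 3}" by auto
    then show ?thesis
      unfolding expo_basis_def[abs_def]
      by (auto intro!: derivative_eq_intros has_vector_derivative_real_field)
  next
    case 2
    have "((\<lambda>x. (cosh (lam * x) - 1 - (lam * x) ^ 2 / 2) / lam ^ 4) has_field_derivative 0)
        (at (of_real 0))"
      using assms(1) by (auto intro!: derivative_eq_intros)
    from has_vector_derivative_real_field[OF this] show ?thesis
      using 2 unfolding expo_basis_def[abs_def] by simp
  next
    case 3
    have "((\<lambda>x. (sinh (lam * x) - lam * x - (lam * x) ^ 3 / fact 3) / lam ^ 5)
        has_field_derivative 0) (at (of_real 0))"
      using assms(1) by (auto intro!: derivative_eq_intros)
    from has_vector_derivative_real_field[OF this] show ?thesis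
      using 3 unfolding expo_basis_def[abs_def] by simp
  qed
  have "((\<lambda>x. Re (expo_basis lam l x)) has_vector_derivative Re (if l = 1 then 1 else 0)) (at 0)"
    using bounded_linear.has_vector_derivative[OF bounded_linear_Re *] .
  then show ?thesis
    by (simp add: has_real_derivative_iff_has_vector_derivative if_distrib[of Re] cong: if_cong)
qed

lemma Re_expo_basis_shift_has_derivative:
  assumes "lam \<noteq> 0" "l \<le> 5"
  shows "((\<lambda>x. Re (expo_basis lam l (x - c))) has_real_derivative (if l = 1 then 1 else 0)) (at c)"
  using Re_expo_basis_has_derivative_0[OF assms]
    DERIV_shift[of "\<lambda>x. Re (expo_basis lam l x)" "if l = 1 then 1 else 0" c "- c"]
  by simp

section \<open>Differentiability under a rank two perturbation\<close>

text \<open>\<open>lagrange_functions\<close> is a purely algebraic condition, so smoothness has to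
  be derived. Contracting the equation with \<open>p\<close> and with \<open>q\<close> gives a 2 by
  2 linear system for the two unknown sums. Its matrix is close to the identity, hence the sums, and
  with them every \<open>L n\<close>, are linear combinations of the \<open>g m\<close>.\<close>

lemma low_rank_perturbation_differentiable:
  fixes L g :: "'i \<Rightarrow> real \<Rightarrow> real" and a b p q :: "'i \<Rightarrow> real"
  assumes eq: "\<And>n x. n \<in> I \<Longrightarrow>
      L n x + a n * (\<Sum>m\<in>I. p m * L m x) + b n * (\<Sum>m\<in>I. q m * L m x) = g n x"
    and g: "\<And>n. n \<in> I \<Longrightarrow> g n differentiable at x0"
    and small: "\<bar>\<Sum>m\<in>I. p m * a m\<bar> < 1/2" "\<bar>\<Sum>m\<in>I. p m * b m\<bar> < 1/2"
      "\<bar>\<Sum>m\<in>I. q m * a m\<bar> < 1/2" "\<bar>\<Sum>m\<in>I. q m * b m\<bar> < 1/2"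
    and "n \<in> I" "finite I"
  shows "L n differentiable at x0"
proof -
  define P Q where "P x = (\<Sum>m\<in>I. p m * L m x)" and "Q x = (\<Sum>m\<in>I. q m * L m x)" for x
  define G K where "G x = (\<Sum>m\<in>I. p m * g m x)" and "K x = (\<Sum>m\<in>I. q m * g m x)" for x
  define pa pb qa qb where "pa = (\<Sum>m\<in>I. p m * a m)" and "pb = (\<Sum>m\<in>I. p m * b m)"
    and "qa = (\<Sum>m\<in>I. q m * a m)" and "qb = (\<Sum>m\<in>I. q m * b m)"
  have L: "L n x = g n x - a n * P x - b n * Q x" if "n \<in> I" for n x
    using eq[OF that, of x] unfolding P_def Q_def by linarith
  have P: "G x = (1 + pa) * P x + pb * Q x" for x
  proof -
    have "P x = (\<Sum>m\<in>I. p m * (g m x - a m * P x - b m * Q x))"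
      unfolding P_def[of x] by (intro sum.cong refl) (simp add: L[unfolded P_def])
    also have "\<dots> = G x - pa * P x - pb * Q x"
      by (simp add: G_def pa_def pb_def algebra_simps sum.distrib sum_subtractf sum_distrib_left)
    finally show ?thesis by (simp add: algebra_simps)
  qed
  have Q: "K x = qa * P x + (1 + qb) * Q x" for x
  proof -
    have "Q x = (\<Sum>m\<in>I. q m * (g m x - a m * P x - b m * Q x))"
      unfolding Q_def[of x] by (intro sum.cong refl) (simp add: L[unfolded Q_def])
    also have "\<dots> = K x - qa * P x - qb * Q x"
      by (simp add: K_def qa_def qb_def algebra_simps sum.distrib sum_subtractf sum_distrib_left)
    finally show ?thesis by (simp add: algebra_simps)
  qed
  define D where "D = (1 + pa) * (1 + qb) - pb * qa"
  \<comment> \<open>Both diagonal entries exceed 1/2, so their product exceeds 1/4, while the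
    off-diagonal product is at most 1/4 in absolute value. The determinant is therefore
    positive.\<close>
  have "1/2 * (1/2) < (1 + pa) * (1 + qb)"
    using small by (intro mult_strict_mono) (auto simp: pa_def qb_def abs_less_iff)
  moreover have "\<bar>pb * qa\<bar> \<le> 1/2 * (1/2)"
    unfolding abs_mult using small by (intro mult_mono) (auto simp: pb_def qa_def)
  ultimately have D: "D \<noteq> 0" unfolding D_def by linarith
  \<comment> \<open>Cramer's rule.\<close>
  have "D * P x = (1 + qb) * G x - pb * K x" "D * Q x = (1 + pa) * K x - qa * G x" for x
    unfolding D_def P Q by algebra+
  then have PQ: "P = (\<lambda>x. ((1 + qb) * G x - pb * K x) / D)"
    "Q = (\<lambda>x. ((1 + pa) * K x - qa * G x) / D)"
    using D by (auto simp: fun_eq_iff field_simps)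
  have "G differentiable at x0" "K differentiable at x0"
    unfolding G_def K_def using g \<open>finite I\<close> by (auto intro!: differentiable_sum)
  then have "P differentiable at x0" "Q differentiable at x0"
    unfolding PQ using D by (auto intro!: derivative_intros)
  moreover have "L n = (\<lambda>x. g n x - a n * P x - b n * Q x)"
    using L[OF \<open>n \<in> I\<close>] by auto
  ultimately show ?thesis
    using g[OF \<open>n \<in> I\<close>] by auto
qed

section \<open>The rows of the Lagrange system in units of the cell size\<close>

text \<open>The basis functions at the stencil nodes in units of the cell size \<^term>\<open>d\<close>, which makes
  the Lagrange system a perturbation of size $d^2$ of the polynomial one.\<close>

definition scaled_basis :: "complex \<Rightarrow> real \<Rightarrow> nat \<Rightarrow> nat \<Rightarrow> real" where
  "scaled_basis lam d l n = Re (expo_basis lam l ((real n - 3) * d)) / d ^ l"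

lemma scaled_basis_le_3:
  assumes "l \<le> 3" "d > 0"
  shows "scaled_basis lam d l n = (real n - 3) ^ l / fact l"
proof -
  have "expo_basis lam l ((real n - 3) * d) = of_real (((real n - 3) * d) ^ l / fact l)"
    using assms(1) by (simp add: expo_basis_def)
  then show ?thesis
    using assms(2) by (simp only: scaled_basis_def Re_complex_of_real) (simp add: power_mult_distrib)
qed

text \<open>The nodes lie within \<open>3 * d\<close> of the boundary, so the threshold 1/3 puts
  \<open>lam\<close> times the node offset into the unit disc. The constant 4 dominates both
  3^8/1680 and 3^9/13440.\<close>

lemma scaled_basis_expansion:
  assumes "l = 4 \<or> l = 5" "n \<le> 5" "lam \<noteq> 0" "d > 0" "norm lam * d \<le> 1/3"
  shows "\<bar>scaled_basis lam d l n - (real n - 3) ^ l / fact l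
      - Re (lam ^ 2) * d ^ 2 * (real n - 3) ^ (l + 2) / fact (l + 2)\<bar> \<le> 4 * norm lam ^ 4 * d ^ 4"
proof -
  define k where "k = real n - 3"
  have k: "\<bar>k\<bar> \<le> 3" using assms(2) by (auto simp: k_def)
  have "norm lam * \<bar>k * d\<bar> = \<bar>k\<bar> * (norm lam * d)"
    using assms(4) by (simp add: abs_mult)
  also have "\<dots> \<le> 3 * (1/3)"
    using k assms by (intro mult_mono) auto
  finally have z: "norm lam * \<bar>k * d\<bar> \<le> 1" by simp
  from assms(1) show ?thesis
  proof
    assume l: "l = 4"
    have "scaled_basis lam d l n - k ^ l / fact l - Re (lam ^ 2) * d ^ 2 * k ^ (l + 2) / fact (l + 2)
      = (Re (expo_basis lam 4 (k * d)) - (k * d) ^ 4 / 24 - Re (lam ^ 2) * (k * d) ^ 6 / 720) / d ^ 4"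
      using assms(4) by (simp add: l scaled_basis_def fact_numeral power_mult_distrib k_def[symmetric] diff_divide_distrib flip: power_add)
         (simp add: field_simps)
    also have "\<bar>\<dots>\<bar> \<le> (norm lam ^ 4 * \<bar>k * d\<bar> ^ 8 / 1680) / d ^ 4"
      using divide_right_mono[OF expo_basis_4_taylor[OF assms(3) z], of "d ^ 4"] assms(4)
      by (simp add: abs_divide)
    also have "\<dots> = norm lam ^ 4 * d ^ 4 * (\<bar>k\<bar> ^ 8 / 1680)"
      using assms(4) by (simp add: abs_mult power_mult_distrib field_simps flip: power_add)
    also have "\<dots> \<le> norm lam ^ 4 * d ^ 4 * (3 ^ 8 / 1680)"
      using k by (intro mult_left_mono divide_right_mono power_mono) auto
    also have "\<dots> \<le> norm lam ^ 4 * d ^ 4 * 4"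
      by (intro mult_left_mono) auto
    finally show ?thesis by (simp add: k_def)
  next
    assume l: "l = 5"
    have "scaled_basis lam d l n - k ^ l / fact l - Re (lam ^ 2) * d ^ 2 * k ^ (l + 2) / fact (l + 2)
      = (Re (expo_basis lam 5 (k * d)) - (k * d) ^ 5 / 120 - Re (lam ^ 2) * (k * d) ^ 7 / 5040) / d ^ 5"
      using assms(4) by (simp add: l scaled_basis_def fact_numeral power_mult_distrib k_def[symmetric] diff_divide_distrib flip: power_add)
         (simp add: field_simps)
    also have "\<bar>\<dots>\<bar> \<le> (norm lam ^ 4 * \<bar>k * d\<bar> ^ 9 / 13440) / d ^ 5"
      using divide_right_mono[OF expo_basis_5_taylor[OF assms(3) z], of "d ^ 5"] assms(4)
      by (simp add: abs_divide)
    also have "\<dots> = norm lam ^ 4 * d ^ 4 * (\<bar>k\<bar> ^ 9 / 13440)"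
      using assms(4) by (simp add: abs_mult power_mult_distrib field_simps flip: power_add)
    also have "\<dots> \<le> norm lam ^ 4 * d ^ 4 * (3 ^ 9 / 13440)"
      using k by (intro mult_left_mono divide_right_mono power_mono) auto
    also have "\<dots> \<le> norm lam ^ 4 * d ^ 4 * 4"
      by (intro mult_left_mono) auto
    finally show ?thesis by (simp add: k_def)
  qed
qed

text \<open>The correction in \<open>lam ^ 2\<close> contributes at most 3/2, since 3^6/6! and
  3^7/7! stay below that. The fourth-order remainder contributes at most 1/2 because
  \<open>norm lam * d\<close> is at most 1/3.\<close>

lemma scaled_basis_near_monomial:
  assumes "l = 4 \<or> l = 5" "n \<le> 5" "lam \<noteq> 0" "d > 0" "norm lam * d \<le> 1/3"
  shows "\<bar>scaled_basis lam d l n - (real n - 3) ^ l / fact l\<bar> \<le> 2 * norm lam ^ 2 * d ^ 2"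
proof -
  define k where "k = real n - 3"
  have k: "\<bar>k\<bar> \<le> 3" using assms(2) by (auto simp: k_def)
  have "\<bar>k ^ (l + 2) / fact (l + 2)\<bar> = \<bar>k\<bar> ^ (l + 2) / fact (l + 2)"
    by (simp add: abs_mult power_abs)
  also have "\<dots> \<le> 3 ^ (l + 2) / fact (l + 2)"
    using k by (intro divide_right_mono power_mono) auto
  also have "\<dots> \<le> 3/2" using assms(1) by (auto simp: fact_numeral)
  finally have c: "\<bar>k ^ (l + 2) / fact (l + 2)\<bar> \<le> 3/2" .
  have "\<bar>Re (lam ^ 2) * d ^ 2 * (k ^ (l + 2) / fact (l + 2))\<bar>
      = \<bar>Re (lam ^ 2)\<bar> * d ^ 2 * \<bar>k ^ (l + 2) / fact (l + 2)\<bar>"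
    by (simp add: abs_mult)
  also have "\<dots> \<le> norm lam ^ 2 * d ^ 2 * (3/2)"
    using abs_Re_le_cmod[of "lam ^ 2"] by (intro mult_mono c) (auto simp: norm_power)
  finally have 1: "\<bar>Re (lam ^ 2) * d ^ 2 * k ^ (l + 2) / fact (l + 2)\<bar>
      \<le> norm lam ^ 2 * d ^ 2 * (3/2)" by simp
  have "4 * norm lam ^ 4 * d ^ 4 = 4 * (norm lam ^ 2 * d ^ 2) * (norm lam * d) ^ 2"
    by algebra
  also have "\<dots> \<le> 4 * (norm lam ^ 2 * d ^ 2) * (1/3) ^ 2"
    using assms by (intro mult_left_mono power_mono) auto
  also have "\<dots> \<le> norm lam ^ 2 * d ^ 2 * (1/2)"
    by (simp add: power_divide)
  finally have 2: "4 * norm lam ^ 4 * d ^ 4 \<le> norm lam ^ 2 * d ^ 2 * (1/2)" .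
  show ?thesis
    using scaled_basis_expansion[OF assms] 1 2 unfolding k_def[symmetric] by linarith
qed

section \<open>Inverting the system through the polynomial Lagrange basis\<close>

lemma cell_boundary_stencil:
  "cell_boundary xb j d (i - 3 + int n) = cell_boundary xb j d i + (real n - 3) * d"
  by (simp add: cell_boundary_def algebra_simps)

text \<open>The values \<open>L n x\<close> are real, so taking real parts of the complex system
  leaves a real one with the same unknowns.\<close>

lemma lagrange_functions_scaled:
  assumes "lagrange_functions lam (cell_boundary xb j d) i L" "l \<le> 5"
  shows "(\<Sum>n\<le>5. L n x * scaled_basis lam d l n)
    = Re (expo_basis lam l (x - cell_boundary xb j d i)) / d ^ l"
proof -
  have "(\<Sum>n\<le>5. of_real (L n x) * expo_basis lam l ((real n - 3) * d))
      = expo_basis lam l (x - cell_boundary xb j d i)"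
    using assms unfolding lagrange_functions_def cell_boundary_stencil by simp
  from arg_cong[OF this, of Re] show ?thesis
    by (simp add: scaled_basis_def sum_divide_distrib[symmetric])
qed

text \<open>Shifting the argument by 1/2 moves the boundary in question to 0 and the nodes to
  \<open>real m - 3\<close>. The numbers \<open>a n l\<close> are the derivatives of order
  \<open>l\<close> of \<open>u n\<close> at 1/2; as a matrix they invert the polynomial moment
  matrix.\<close>

lemma interpolation_coefficients:
  fixes u :: "nat \<Rightarrow> real poly"
  assumes "\<And>n. n \<le> 5 \<Longrightarrow> degree (u n) = 5"
    and "\<And>n m. n \<le> 5 \<Longrightarrow> m \<le> 5 \<Longrightarrow> poly (u n) (- 5/2 + real m) = (if n = m then 1 else 0)"
  obtains a :: "nat \<Rightarrow> nat \<Rightarrow> real" where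
    "\<And>n m. n \<le> 5 \<Longrightarrow> m \<le> 5 \<Longrightarrow>
      (\<Sum>l\<le>5. a n l * ((real m - 3) ^ l / fact l)) = (if n = m then 1 else 0)"
    "\<And>n. a n 1 = poly (pderiv (u n)) (1/2)"
proof -
  define v where "v n = pcompose (u n) [:1/2, 1:]" for n
  show thesis
  proof (rule that)
    fix n m :: nat assume nm: "n \<le> 5" "m \<le> 5"
    \<comment> \<open>The degree fixes the range of the coefficient sum to \<open>l\<close> up to
      5.\<close>
    have "degree (v n) = 5" unfolding v_def using assms(1)[OF nm(1)] by (simp add: degree_pcompose)
    then have "(\<Sum>l\<le>5. coeff (v n) l * fact l * ((real m - 3) ^ l / fact l)) = poly (v n) (real m - 3)"
      by (simp add: poly_altdef)
    also have "\<dots> = (if n = m then 1 else 0)"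
      using assms(2)[OF nm] by (simp add: v_def poly_pcompose algebra_simps)
    finally show "(\<Sum>l\<le>5. coeff (v n) l * fact l * ((real m - 3) ^ l / fact l)) = (if n = m then 1 else 0)" .
  next
    fix n
    have "coeff (v n) 1 = poly (pderiv (v n)) 0"
      by (simp add: poly_0_coeff_0 coeff_pderiv)
    also have "\<dots> = poly (pderiv (u n)) (1/2)"
      by (simp add: v_def pderiv_pcompose poly_pcompose pderiv_pCons)
    finally show "coeff (v n) 1 * fact 1 = poly (pderiv (u n)) (1/2)" by simp
  qed
qed

text \<open>Applying the inverse \<open>a\<close> of the polynomial matrix to the scaled system
  gives the identity plus a remainder. The remainder comes from rows 4 and 5 alone, as rows 0 to 3
  are exact, so it has rank at most two. It is used for the functions \<open>L n\<close> and again
  for the weights of the flux.\<close>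

lemma scaled_system_perturbation:
  fixes a :: "nat \<Rightarrow> nat \<Rightarrow> real" and y :: "nat \<Rightarrow> real"
  assumes dual: "\<And>n m. n \<le> 5 \<Longrightarrow> m \<le> 5 \<Longrightarrow>
      (\<Sum>l\<le>5. a n l * ((real m - 3) ^ l / fact l)) = (if n = m then 1 else 0)"
    and "d > 0" "n \<le> 5"
  shows "y n
      + a n 4 * (\<Sum>m\<le>5. (scaled_basis lam d 4 m - (real m - 3) ^ 4 / fact 4) * y m)
      + a n 5 * (\<Sum>m\<le>5. (scaled_basis lam d 5 m - (real m - 3) ^ 5 / fact 5) * y m)
    = (\<Sum>l\<le>5. a n l * (\<Sum>m\<le>5. y m * scaled_basis lam d l m))"
proof -
  let ?b = "\<lambda>l m. (real m - 3) ^ l / fact l"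
  let ?r = "\<lambda>l m. scaled_basis lam d l m - ?b l m"
  have "(\<Sum>l\<le>5. a n l * (\<Sum>m\<le>5. y m * scaled_basis lam d l m))
      = (\<Sum>l\<le>5. a n l * (\<Sum>m\<le>5. y m * ?b l m)) + (\<Sum>l\<le>5. a n l * (\<Sum>m\<le>5. ?r l m * y m))"
    by (simp add: sum_distrib_left algebra_simps flip: sum.distrib)
  also have "(\<Sum>l\<le>5. a n l * (\<Sum>m\<le>5. y m * ?b l m)) = (\<Sum>m\<le>5. y m * (\<Sum>l\<le>5. a n l * ?b l m))"
    unfolding sum_distrib_left by (subst sum.swap) (simp add: algebra_simps)
  also have "\<dots> = (\<Sum>m\<le>5. y m * (if n = m then 1 else 0))"
    using dual[OF \<open>n \<le> 5\<close>] by (intro sum.cong) auto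
  also have "\<dots> = y n"
    using \<open>n \<le> 5\<close> by (simp add: if_distrib cong: if_cong)
  also have "(\<Sum>l\<le>5. a n l * (\<Sum>m\<le>5. ?r l m * y m)) = (\<Sum>l\<in>{4, 5}. a n l * (\<Sum>m\<le>5. ?r l m * y m))"
  proof (rule sum.mono_neutral_right)
    show "\<forall>l\<in>{..5} - {4, 5}. a n l * (\<Sum>m\<le>5. ?r l m * y m) = 0"
    proof
      fix l :: nat assume "l \<in> {..5} - {4, 5}"
      then have "l \<le> 3" by auto
      then show "a n l * (\<Sum>m\<le>5. ?r l m * y m) = 0"
        using \<open>d > 0\<close> by (simp add: scaled_basis_le_3)
    qed
  qed auto
  finally show ?thesis by simp
qed

text \<open>At each \<open>x\<close> the values \<open>L n x\<close> satisfy a rank two perturbation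
  of an explicit combination of basis functions. The condition \<open>small\<close> keeps the four
  contracted coefficients below 1/2.\<close>

lemma lagrange_functions_differentiable:
  fixes a :: "nat \<Rightarrow> nat \<Rightarrow> real"
  assumes dual: "\<And>n m. n \<le> 5 \<Longrightarrow> m \<le> 5 \<Longrightarrow>
      (\<Sum>l\<le>5. a n l * ((real m - 3) ^ l / fact l)) = (if n = m then 1 else 0)"
    and L: "lagrange_functions lam (cell_boundary xb j d) i L"
    and "lam \<noteq> 0" "d > 0" "norm lam * d \<le> 1/3"
    and small: "2 * norm lam ^ 2 * d ^ 2 * (\<Sum>m\<le>5. \<bar>a m 4\<bar> + \<bar>a m 5\<bar>) < 1/2"
    and "n \<le> 5"
  shows "L n differentiable at (cell_boundary xb j d i)"
proof -
  let ?x0 = "cell_boundary xb j d i"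
  let ?r = "\<lambda>l m. scaled_basis lam d l m - (real m - 3) ^ l / fact l"
  let ?g = "\<lambda>n x. \<Sum>l\<le>5. a n l * (Re (expo_basis lam l (x - ?x0)) / d ^ l)"
  have g: "?g n differentiable at ?x0" for n
  proof -
    have "(\<lambda>x. Re (expo_basis lam l (x - ?x0))) differentiable at ?x0" if "l \<le> 5" for l
      using Re_expo_basis_shift_has_derivative[OF \<open>lam \<noteq> 0\<close> that] real_differentiable_def by blast

    then show ?thesis using \<open>d > 0\<close>
      by (intro differentiable_sum ballI differentiable_mult differentiable_const differentiable_divide) auto
  qed
  have b: "\<bar>\<Sum>m\<le>5. ?r l m * a m l'\<bar> < 1/2" if "l = 4 \<or> l = 5" "l' = 4 \<or> l' = 5" for l l'
  proof -
    have "\<bar>\<Sum>m\<le>5. ?r l m * a m l'\<bar> \<le> (\<Sum>m\<le>5. \<bar>?r l m\<bar> * \<bar>a m l'\<bar>)"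
      by (rule order_trans[OF sum_abs]) (simp add: abs_mult)
    also have "\<dots> \<le> (\<Sum>m\<le>5. 2 * norm lam ^ 2 * d ^ 2 * (\<bar>a m 4\<bar> + \<bar>a m 5\<bar>))"
      using that assms by (intro sum_mono mult_mono scaled_basis_near_monomial) auto
    also have "\<dots> < 1/2" using small by (simp add: sum_distrib_left)
    finally show ?thesis .
  qed
  show ?thesis
  proof (rule low_rank_perturbation_differentiable[where I = "{..5}" and g = ?g
        and a = "\<lambda>n. a n 4" and b = "\<lambda>n. a n 5" and p = "?r 4" and q = "?r 5"])
    fix n :: nat and x assume "n \<in> {..5}"
    then show "L n x + a n 4 * (\<Sum>m\<le>5. ?r 4 m * L m x) + a n 5 * (\<Sum>m\<le>5. ?r 5 m * L m x) = ?g n x"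
      using scaled_system_perturbation[OF dual \<open>d > 0\<close>, where y = "\<lambda>n. L n x" and n = n]
        lagrange_functions_scaled[OF L] by simp
  qed (use g b \<open>n \<le> 5\<close> in auto)
qed

text \<open>The left side of the Lagrange system is differentiated at the boundary term by term, the
  right side through the known slopes; uniqueness of the derivative equates the results. For
  \<open>l = 1\<close> the slope 1/d is offset by the factor \<open>d\<close> in the
  weights.\<close>

lemma lagrange_derivative_moments:
  assumes L: "lagrange_functions lam (cell_boundary xb j d) i L"
    and diff: "\<And>n. n \<le> 5 \<Longrightarrow> L n differentiable at (cell_boundary xb j d i)"
    and "lam \<noteq> 0" "d > 0" "l \<le> 5"
  shows "(\<Sum>n\<le>5. d * deriv (L n) (cell_boundary xb j d i) * scaled_basis lam d l n)
    = (if l = 1 then 1 else 0)"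
proof -
  let ?x0 = "cell_boundary xb j d i"
  have D: "((\<lambda>x. \<Sum>n\<le>5. L n x * scaled_basis lam d l n) has_real_derivative
      (\<Sum>n\<le>5. deriv (L n) ?x0 * scaled_basis lam d l n)) (at ?x0)"
    using diff by (intro DERIV_sum DERIV_cmult_right)
      (auto simp: DERIV_deriv_iff_real_differentiable)
  from DERIV_cdivide[OF Re_expo_basis_shift_has_derivative[OF \<open>lam \<noteq> 0\<close> \<open>l \<le> 5\<close>, of ?x0], of "d ^ l"]
  have "((\<lambda>x. \<Sum>n\<le>5. L n x * scaled_basis lam d l n) has_real_derivative
      (if l = 1 then 1 else 0) / d ^ l) (at ?x0)"
    unfolding lagrange_functions_scaled[OF L \<open>l \<le> 5\<close>] .
  from DERIV_unique[OF D this] show ?thesis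
    using \<open>d > 0\<close> by (auto simp: sum_distrib_left[symmetric] mult.assoc)
qed

text \<open>Without the rank two remainder the weights would be exactly \<open>a n 1\<close>. The
  remainder is of order d^2 times the sum \<open>W\<close> of all absolute weights, so
  \<open>W\<close> is bounded first and the bound is then reinserted.\<close>

lemma moment_weights_near_polynomial_weights:
  fixes a :: "nat \<Rightarrow> nat \<Rightarrow> real" and w :: "nat \<Rightarrow> real"
  assumes dual: "\<And>n m. n \<le> 5 \<Longrightarrow> m \<le> 5 \<Longrightarrow>
      (\<Sum>l\<le>5. a n l * ((real m - 3) ^ l / fact l)) = (if n = m then 1 else 0)"
    and w: "\<And>l. l \<le> 5 \<Longrightarrow> (\<Sum>n\<le>5. w n * scaled_basis lam d l n) = (if l = 1 then 1 else 0)"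
    and "lam \<noteq> 0" "d > 0" "norm lam * d \<le> 1/3"
    and small: "2 * norm lam ^ 2 * d ^ 2 * (\<Sum>m\<le>5. \<bar>a m 4\<bar> + \<bar>a m 5\<bar>) < 1/2"
    and "n \<le> 5"
  shows "\<bar>w n - a n 1\<bar>
    \<le> 4 * norm lam ^ 2 * d ^ 2 * (\<Sum>m\<le>5. \<bar>a m 4\<bar> + \<bar>a m 5\<bar>) * (\<Sum>m\<le>5. \<bar>a m 1\<bar>)"
proof -
  let ?r = "\<lambda>l m. scaled_basis lam d l m - (real m - 3) ^ l / fact l"
  define e where "e = 2 * norm lam ^ 2 * d ^ 2"
  define A where "A = (\<Sum>m\<le>5. \<bar>a m 4\<bar> + \<bar>a m 5\<bar>)"
  define W where "W = (\<Sum>m\<le>5. \<bar>w m\<bar>)"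
  have e: "e \<ge> 0" and W: "W \<ge> 0" by (auto simp: e_def W_def intro: sum_nonneg)
  have r: "\<bar>\<Sum>m\<le>5. ?r l m * w m\<bar> \<le> e * W" if "l = 4 \<or> l = 5" for l
  proof -
    have "\<bar>\<Sum>m\<le>5. ?r l m * w m\<bar> \<le> (\<Sum>m\<le>5. \<bar>?r l m\<bar> * \<bar>w m\<bar>)"
      by (rule order_trans[OF sum_abs]) (simp add: abs_mult)
    also have "\<dots> \<le> (\<Sum>m\<le>5. e * \<bar>w m\<bar>)"
      unfolding e_def using that assms by (intro sum_mono mult_right_mono scaled_basis_near_monomial) auto
    finally show ?thesis by (simp add: sum_distrib_left W_def)
  qed
  have *: "\<bar>w n - a n 1\<bar> \<le> (\<bar>a n 4\<bar> + \<bar>a n 5\<bar>) * (e * W)" if "n \<le> 5" for n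
  proof -
    have "(\<Sum>l\<le>5. a n l * (\<Sum>m\<le>5. w m * scaled_basis lam d l m)) = (\<Sum>l\<le>5. a n l * (if l = 1 then 1 else 0))"
      using w by (intro sum.cong) auto
    also have "\<dots> = a n 1" by (simp add: if_distrib cong: if_cong)
    finally have "w n - a n 1 = - (a n 4 * (\<Sum>m\<le>5. ?r 4 m * w m)) - a n 5 * (\<Sum>m\<le>5. ?r 5 m * w m)"
      using scaled_system_perturbation[OF dual \<open>d > 0\<close> that, where y = w and lam = lam] by simp
    then have "\<bar>w n - a n 1\<bar> \<le> \<bar>a n 4\<bar> * \<bar>\<Sum>m\<le>5. ?r 4 m * w m\<bar> + \<bar>a n 5\<bar> * \<bar>\<Sum>m\<le>5. ?r 5 m * w m\<bar>"
      unfolding abs_mult[symmetric] by linarith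
    also have "\<dots> \<le> \<bar>a n 4\<bar> * (e * W) + \<bar>a n 5\<bar> * (e * W)"
      by (intro add_mono mult_left_mono r) auto
    finally show ?thesis by (simp add: algebra_simps)
  qed
  \<comment> \<open>Summing the estimate over \<open>n\<close> gives \<open>W\<close> at most a
    constant plus \<open>W / 2\<close>, and the last term is absorbed on the left.\<close>
  have "W \<le> (\<Sum>m\<le>5. \<bar>a m 1\<bar> + (\<bar>a m 4\<bar> + \<bar>a m 5\<bar>) * (e * W))"
    unfolding W_def[of] by (rule sum_mono) (use * in \<open>fastforce simp: W_def\<close>)
  also have "\<dots> = (\<Sum>m\<le>5. \<bar>a m 1\<bar>) + (e * A) * W"
    by (simp add: A_def sum.distrib algebra_simps flip: sum_distrib_left)
  also have "\<dots> \<le> (\<Sum>m\<le>5. \<bar>a m 1\<bar>) + 1/2 * W"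
    using small W by (intro add_left_mono mult_right_mono) (auto simp: e_def A_def)
  finally have W2: "W \<le> 2 * (\<Sum>m\<le>5. \<bar>a m 1\<bar>)" by simp
  have "\<bar>w n - a n 1\<bar> \<le> (\<bar>a n 4\<bar> + \<bar>a n 5\<bar>) * (e * W)"
    using * \<open>n \<le> 5\<close> .
  also have "\<dots> \<le> A * (e * (2 * (\<Sum>m\<le>5. \<bar>a m 1\<bar>)))"
    using e W W2 \<open>n \<le> 5\<close> unfolding A_def
    by (intro mult_mono member_le_sum[of n "{..5}" "\<lambda>m. \<bar>a m 4\<bar> + \<bar>a m 5\<bar>"]) (auto intro!: sum_nonneg)
  finally show ?thesis by (simp add: e_def A_def algebra_simps)
qed

section \<open>Taylor expansion of \<open>H\<close> and growth bounds near the limit point\<close>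

text \<open>The expansion is about the moving point \<open>c\<close>, but its top coefficient is
  frozen at \<open>x0\<close>. The intermediate point of the Lagrange remainder stays within
  \<open>r\<close> of \<open>x0\<close>, so a Lipschitz bound at the single point \<open>x0\<close>
  gains one order without a further derivative.\<close>

lemma taylor_remainder_lipschitz:
  fixes f :: "real \<Rightarrow> real"
  assumes "n > 0"
    and deriv: "\<And>m x. m < n \<Longrightarrow> \<bar>x - x0\<bar> \<le> r \<Longrightarrow>
      (nth_deriv m f has_real_derivative nth_deriv (Suc m) f x) (at x)"
    and lip: "\<And>x. \<bar>x - x0\<bar> \<le> r \<Longrightarrow> \<bar>nth_deriv n f x - nth_deriv n f x0\<bar> \<le> C * \<bar>x - x0\<bar>"
    and "C \<ge> 0" "\<bar>c - x0\<bar> \<le> r" "\<bar>x - x0\<bar> \<le> r"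
  shows "\<bar>f x - (\<Sum>m<n. nth_deriv m f c / fact m * (x - c) ^ m)
      - nth_deriv n f x0 / fact n * (x - c) ^ n\<bar> \<le> C * r * \<bar>x - c\<bar> ^ n"
proof (cases "x = c")
  case True
  \<comment> \<open>\<open>Taylor\<close> requires distinct points; for \<open>x = c\<close> only
    the term \<open>m = 0\<close> survives, as \<open>0 ^ 0 = 1\<close>.\<close>
  have "(\<Sum>m<n. nth_deriv m f c / fact m * 0 ^ m) = (\<Sum>m\<in>{0}. nth_deriv m f c / fact m * 0 ^ m)"
    using \<open>n > 0\<close> by (intro sum.mono_neutral_right) auto
  then show ?thesis using True \<open>n > 0\<close> by (simp add: zero_power)
next
  case False
  obtain t where t: "if x < c then x < t \<and> t < c else c < t \<and> t < x"
    and ft: "f x = (\<Sum>m<n. nth_deriv m f c / fact m * (x - c) ^ m) + nth_deriv n f t / fact n * (x - c) ^ n"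
    using Taylor[of n "\<lambda>m. nth_deriv m f" f "x0 - r" "x0 + r" c x] assms False
    by (auto simp: abs_le_iff)
  have tr: "\<bar>t - x0\<bar> \<le> r" using t assms by (auto split: if_splits)
  have "\<bar>f x - (\<Sum>m<n. nth_deriv m f c / fact m * (x - c) ^ m) - nth_deriv n f x0 / fact n * (x - c) ^ n\<bar>
      = \<bar>nth_deriv n f t - nth_deriv n f x0\<bar> * \<bar>x - c\<bar> ^ n / fact n"
    unfolding ft by (simp add: abs_mult power_abs flip: left_diff_distrib diff_divide_distrib)
  also have "\<dots> \<le> \<bar>nth_deriv n f t - nth_deriv n f x0\<bar> * \<bar>x - c\<bar> ^ n / 1"
    by (intro divide_left_mono) (auto simp: fact_ge_1)
  also have "\<dots> \<le> C * r * \<bar>x - c\<bar> ^ n"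
  proof -
    have "\<bar>nth_deriv n f t - nth_deriv n f x0\<bar> \<le> C * r"
      using lip[OF tr] tr \<open>C \<ge> 0\<close> by (meson mult_left_mono order_trans)
    then show ?thesis by (simp add: mult_right_mono)
  qed
  finally show ?thesis .
qed

text \<open>The chain rule at 0 also covers zero and negative \<open>c\<close>. The offsets that
  occur are 0 and -1 for the boundaries and -1/2 for the cell center.\<close>

lemma differentiable_imp_bigo_increment:
  fixes f :: "real \<Rightarrow> real"
  assumes "f differentiable at x0"
  shows "(\<lambda>d. f (x0 + c * d) - f x0) \<in> O[at_right 0](\<lambda>d. d)"
proof -
  obtain D where D: "(f has_real_derivative D) (at (x0 + c * 0))"
    using assms real_differentiable_def by auto
  have "((\<lambda>d. f (x0 + c * d)) has_real_derivative D * c) (at 0)"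
    by (rule DERIV_chain2[where f = f and g = "\<lambda>d. x0 + c * d" and x = 0, OF D]) (auto intro!: derivative_eq_intros)
  then have "((\<lambda>d. (f (x0 + c * d) - f x0) / d) \<longlongrightarrow> D * c) (at 0)"
    by (simp add: DERIV_def)
  then have "((\<lambda>d. (f (x0 + c * d) - f x0) / d) \<longlongrightarrow> D * c) (at_right 0)"
    by (rule tendsto_mono[rotated]) (simp add: at_le)
  then show ?thesis
    by (rule bigoI_tendsto) (simp add: eventually_at_filter)
qed

lemma bigo_self_at_right_0: "(\<lambda>d::real. d) \<in> O[at_right 0](\<lambda>_. 1)"
proof (rule bigoI_tendsto)
  show "((\<lambda>d::real. d / 1) \<longlongrightarrow> 0) (at_right 0)" by (simp add: tendsto_ident_at)
qed auto

lemma bigo_power_mono_at_right_0: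
  assumes "m \<le> n"
  shows "(\<lambda>d::real. d ^ n) \<in> O[at_right 0](\<lambda>d. d ^ m)"
proof -
  have "(\<lambda>d::real. d ^ m * d ^ (n - m)) \<in> O[at_right 0](\<lambda>d. d ^ m * 1 ^ (n - m))"
    by (intro landau_o.big.mult landau_o.big_power bigo_self_at_right_0) auto
  then show ?thesis using assms by (simp flip: power_add)
qed

lemma differentiable_imp_bigo_1:
  fixes f :: "real \<Rightarrow> real"
  assumes "f differentiable at x0"
  shows "(\<lambda>d. f (x0 + c * d)) \<in> O[at_right 0](\<lambda>_. 1)"
proof -
  have "(\<lambda>d. (f (x0 + c * d) - f x0) + f x0) \<in> O[at_right 0](\<lambda>_. 1)"
    using landau_o.big.trans[OF differentiable_imp_bigo_increment[OF assms] bigo_self_at_right_0]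
    by (intro sum_in_bigo(1)) auto
  then show ?thesis by (simp only: diff_add_cancel)
qed

lemma weighted_sum_taylor:
  fixes H :: "real \<Rightarrow> real"
  shows "(\<Sum>n\<le>5. w n * ((\<Sum>m<7. nth_deriv m H c / fact m * (k n * d) ^ m) + D / fact 7 * (k n * d) ^ 7 + R n))
    = (\<Sum>m<7. nth_deriv m H c * d ^ m * (\<Sum>n\<le>5. w n * (k n ^ m / fact m)))
      + D * d ^ 7 * (\<Sum>n\<le>5. w n * (k n ^ 7 / fact 7)) + (\<Sum>n\<le>(5::nat). w n * R n)"
proof -
  have "(\<Sum>n\<le>5. w n * (\<Sum>m<7. nth_deriv m H c / fact m * (k n * d) ^ m))
      = (\<Sum>m<7. nth_deriv m H c * d ^ m * (\<Sum>n\<le>5. w n * (k n ^ m / fact m)))"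
    unfolding sum_distrib_left by (subst sum.swap) (simp add: power_mult_distrib mult_ac)
  moreover have "(\<Sum>n\<le>5. w n * (D / fact 7 * (k n * d) ^ 7)) = D * d ^ 7 * (\<Sum>n\<le>5. w n * (k n ^ 7 / fact 7))"
    unfolding sum_distrib_left by (simp add: power_mult_distrib mult_ac)
  ultimately show ?thesis by (simp only: distrib_left sum.distrib)
qed

text \<open>The tension condition is of second order because the error contains (lam^2 H^(4) -
  H^(6)) S_6 d^5, which has to be O(d^7). The increment bound on the seventh derivative at
  \<open>xb\<close> controls the Taylor remainder and the move of the constant to the cell
  center.\<close>

theorem theorem3p6:
  fixes H h :: "real \<Rightarrow> real" and \<Omega> :: "real set" and xb :: real and i j :: int
    and X :: "real \<Rightarrow> int \<Rightarrow> real" and lam :: "real \<Rightarrow> complex"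
    and L :: "real \<Rightarrow> nat \<Rightarrow> real \<Rightarrow> real" and u :: "nat \<Rightarrow> real poly"
  assumes "open \<Omega>" and "xb \<in> \<Omega>"
    and "H \<in> W_inf 7 \<Omega>"
    and "(\<lambda>x. nth_deriv 7 H x - nth_deriv 7 H xb) \<in> O[at xb](\<lambda>x. x - xb)"
    and "\<And>x. x \<in> \<Omega> \<Longrightarrow> (H has_real_derivative h x) (at x)"
    and "\<And>dx. X dx = cell_boundary xb j dx"
    and "i \<in> {j, j - 1}"
    and "nth_deriv 4 H xb \<noteq> 0" and "nth_deriv 6 H xb \<noteq> 0"
    and "\<forall>\<^sub>F dx in at_right 0. lam dx \<in> \<real> \<union> (\<lambda>t. \<i> * t) ` \<real> \<and> lam dx \<noteq> 0"
    and "(\<lambda>dx. lam dx ^ 2 - of_real (nth_deriv 6 H (X dx i) / nth_deriv 4 H (X dx i)))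
           \<in> O[at_right 0](\<lambda>dx. of_real dx ^ 2)"
    and "\<forall>\<^sub>F dx in at_right 0. lagrange_functions (lam dx) (X dx) i (L dx)"
    and "\<And>n. n \<le> 5 \<Longrightarrow> degree (u n) = 5"
    and "\<And>n m. n \<le> 5 \<Longrightarrow> m \<le> 5 \<Longrightarrow> poly (u n) (- 5/2 + real m) = (if n = m then 1 else 0)"
  shows "(\<lambda>dx. h (X dx i) - num_flux (L dx) (X dx) i H
                - leading_const H u (cell_center (X dx) j) * dx ^ 6)
           \<in> O[at_right 0](\<lambda>dx. dx ^ 7)"
proof -

  \<comment> \<open>Grid geometry and regularity of \<open>H\<close> near \<open>xb\<close>\<close>
  define e :: real where "e = of_int (i - j)"
  have e: "\<bar>e\<bar> \<le> 1" using assms(7) by (auto simp: e_def)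
  have Xi: "X d i = xb + e * d" for d
    by (simp add: assms(6) cell_boundary_def e_def)
  \<comment> \<open>The center lies half a cell to the left of \<open>xb\<close>, whichever of the
    two boundaries \<open>i\<close> names.\<close>
  have Xj: "cell_center (X d) j = xb + (-1/2) * d" for d
    by (simp add: assms(6) cell_boundary_def cell_center_def)
  have Xn: "X d (i - 3 + int n) = X d i + (real n - 3) * d" for d n
    by (simp add: assms(6) cell_boundary_stencil)
  have dH: "(nth_deriv m H has_real_derivative nth_deriv (Suc m) H x) (at x)"
    if "m < 7" "x \<in> \<Omega>" for m x
    using assms(3) that by (auto simp: W_inf_def)
  have diffH: "nth_deriv m H differentiable at xb" if "m < 7" for m
    using dH[OF that assms(2)] real_differentiable_def by blast

  obtain C where "C > 0" and "\<forall>\<^sub>F x in at xb. norm (nth_deriv 7 H x - nth_deriv 7 H xb) \<le> C * norm (x - xb)"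
    using assms(4) by (elim landau_o.bigE)
  then obtain r1 where "r1 > 0" and r1: "\<And>x. x \<noteq> xb \<Longrightarrow> \<bar>x - xb\<bar> < r1 \<Longrightarrow>
      \<bar>nth_deriv 7 H x - nth_deriv 7 H xb\<bar> \<le> C * \<bar>x - xb\<bar>"
    unfolding eventually_at by (auto simp: dist_real_def)
  obtain r2 where "r2 > 0" and r2: "\<And>x. \<bar>x - xb\<bar> < r2 \<Longrightarrow> x \<in> \<Omega>"
    using assms(1,2) by (auto simp: open_real)
  define r where "r = min r1 r2"
  have "r > 0" using \<open>r1 > 0\<close> \<open>r2 > 0\<close> by (simp add: r_def)
  have lip: "\<bar>nth_deriv 7 H x - nth_deriv 7 H xb\<bar> \<le> C * \<bar>x - xb\<bar>" if "\<bar>x - xb\<bar> < r" for x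
    using r1[of x] that by (cases "x = xb") (auto simp: r_def)
  have near: "x \<in> \<Omega>" if "\<bar>x - xb\<bar> < r" for x
    using r2 that by (auto simp: r_def)

  \<comment> \<open>Polynomial reference weights and bounds on the tension parameter\<close>
  obtain a where dual: "\<And>n m. n \<le> 5 \<Longrightarrow> m \<le> 5 \<Longrightarrow>
      (\<Sum>l\<le>5. a n l * ((real m - 3) ^ l / fact l)) = (if n = m then 1 else 0)"
    and a1: "\<And>n. a n 1 = poly (pderiv (u n)) (1/2)"
    using interpolation_coefficients[OF assms(13,14)] by blast
  define A where "A = (\<Sum>m\<le>5. \<bar>a m 4\<bar> + \<bar>a m 5\<bar>)"
  have "A \<ge> 0" by (auto simp: A_def intro: sum_nonneg)

  \<comment> \<open>For real or purely imaginary \<open>lam d\<close> the square is real, so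
    \<open>\<mu> d\<close> is the square itself.\<close>
  define \<mu> where "\<mu> d = Re (lam d ^ 2)" for d
  define q where "q x = nth_deriv 6 H x / nth_deriv 4 H x" for x
  have diffq: "q differentiable at xb"
    unfolding q_def using diffH assms(8) by (intro differentiable_divide) auto
  have q1: "(\<lambda>d. q (X d i)) \<in> O[at_right 0](\<lambda>_. 1)"
    unfolding Xi by (rule differentiable_imp_bigo_1[OF diffq])
  obtain c where "c > 0" and lam2: "\<forall>\<^sub>F d in at_right 0. norm (lam d ^ 2 - of_real (q (X d i))) \<le> c * norm (complex_of_real d ^ 2)"
    using assms(11) unfolding q_def[symmetric] by (elim landau_o.bigE)
  have \<mu>: "(\<lambda>d. \<mu> d - q (X d i)) \<in> O[at_right 0](\<lambda>d. d ^ 2)"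
  proof (rule bigoI)
    show "\<forall>\<^sub>F d in at_right 0. norm (\<mu> d - q (X d i)) \<le> c * norm (d ^ 2)"
      using lam2
    proof eventually_elim
      case (elim d)
      have "norm (\<mu> d - q (X d i)) \<le> norm (lam d ^ 2 - of_real (q (X d i)))"
        using abs_Re_le_cmod[of "lam d ^ 2 - of_real (q (X d i))"] by (simp add: \<mu>_def)
      then show ?case using elim by (simp add: norm_power)
    qed
  qed
  obtain c' where "c' > 0" and qc: "\<forall>\<^sub>F d in at_right 0. norm (q (X d i)) \<le> c' * norm (1::real)"
    using q1 by (elim landau_o.bigE)
  have d01: "\<forall>\<^sub>F d in at_right (0::real). 0 < d" "\<forall>\<^sub>F d in at_right (0::real). d < 1"
    by (auto simp: eventually_at_right_less intro!: eventually_at_right_real order_tendstoD(2)[OF tendsto_ident_at])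
  \<comment> \<open>For \<open>d < 1\<close> the deviation of the square from \<open>q\<close> is at
    most \<open>c\<close>, and \<open>q\<close> itself is at most \<open>c'\<close> near
    \<open>xb\<close>.\<close>
  define \<Lambda> where "\<Lambda> = c + c'"
  have "\<forall>\<^sub>F d in at_right 0. norm (lam d ^ 2) \<le> \<Lambda>"
    using lam2 qc d01
  proof eventually_elim
    case (elim d)
    have "norm (lam d ^ 2) \<le> norm (lam d ^ 2 - of_real (q (X d i))) + norm (complex_of_real (q (X d i)))"
      by norm
    also have "\<dots> \<le> c * norm (complex_of_real d ^ 2) + c'"
      using elim by simp
    also have "c * norm (complex_of_real d ^ 2) \<le> c * 1"
      using elim \<open>c > 0\<close> by (intro mult_left_mono) (auto simp: norm_power power_le_one)
    finally show ?case by (simp add: \<Lambda>_def)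
  qed
  then have \<Lambda>: "\<forall>\<^sub>F d in at_right 0. norm (lam d) ^ 2 \<le> \<Lambda>"
    by (simp add: norm_power)

  have dlim: "((\<lambda>d::real. c * d) \<longlongrightarrow> c * 0) (at_right 0)" for c
    by (intro tendsto_intros)
  have dlim2: "((\<lambda>d::real. c * d ^ 2) \<longlongrightarrow> c * 0 ^ 2) (at_right 0)" for c
    by (intro tendsto_intros)
  \<comment> \<open>The bound 1/3 serves the expansion of the basis, 1/2 the inversion of the
    system. The condition \<open>4 * d < r\<close> keeps the whole stencil near \<open>xb\<close>:
    at most \<open>d\<close> to the boundary and \<open>3 * d\<close> to a node.\<close>
  have ev: "\<forall>\<^sub>F d in at_right 0. d > 0 \<and> lam d \<noteq> 0 \<and> norm (lam d) ^ 2 \<le> \<Lambda> \<and>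
      norm (lam d) * d \<le> 1/3 \<and> 2 * norm (lam d) ^ 2 * d ^ 2 * A < 1/2 \<and> 4 * d < r \<and>
      lagrange_functions (lam d) (cell_boundary xb j d) i (L d)"
  proof -
    have "\<forall>\<^sub>F d in at_right 0. \<Lambda> * d ^ 2 < (1/3) ^ 2" "\<forall>\<^sub>F d in at_right 0. 2 * \<Lambda> * A * d ^ 2 < 1/2"
      "\<forall>\<^sub>F d in at_right 0. 4 * d < r"
      using order_tendstoD(2)[OF dlim2[of \<Lambda>], of "(1/3) ^ 2"]
        order_tendstoD(2)[OF dlim2[of "2 * \<Lambda> * A"], of "1/2"]
        order_tendstoD(2)[OF dlim[of 4], of r] \<open>r > 0\<close>
      by simp_all
    moreover have "\<forall>\<^sub>F d in at_right (0::real). d > 0"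
      by (simp add: eventually_at_right_less)
    ultimately show ?thesis
      using assms(10) assms(12) \<Lambda>
    proof eventually_elim
      case (elim d)
      have "(norm (lam d) * d) ^ 2 \<le> \<Lambda> * d ^ 2"
        using elim by (simp add: power_mult_distrib mult_right_mono)
      also have "\<dots> \<le> (1/3) ^ 2"
        using elim(1) by (rule less_imp_le)
      finally have "norm (lam d) * d \<le> 1/3"
        by (rule power2_le_imp_le) simp
      moreover have "2 * norm (lam d) ^ 2 * d ^ 2 * A \<le> 2 * \<Lambda> * d ^ 2 * A"
        using elim \<open>A \<ge> 0\<close> by (intro mult_right_mono mult_left_mono) auto
      then have "2 * norm (lam d) ^ 2 * d ^ 2 * A < 1/2"
        using elim(2) by (simp only: mult_ac)
      ultimately show ?case using elim unfolding assms(6) by blast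
    qed
  qed

  \<comment> \<open>Flux weights and their moments\<close>
  define w where "w d n = d * deriv (L d n) (X d i)" for d n
  define k where "k n = real n - 3" for n
  define S where "S d m = (\<Sum>n\<le>5. w d n * (k n ^ m / fact m))" for d m
  \<comment> \<open>These are the moments of the polynomial weights, the limits of
    \<open>S d m\<close>; \<open>\<sigma> 7\<close> is the sum in the leading constant.\<close>
  define \<sigma> where "\<sigma> m = (\<Sum>n\<le>5. a n 1 * (k n ^ m / fact m))" for m

  have moments: "\<forall>\<^sub>F d in at_right 0. \<forall>l\<le>5.
      (\<Sum>n\<le>5. w d n * scaled_basis (lam d) d l n) = (if l = 1 then 1 else 0)"
    using ev
  proof eventually_elim
    case (elim d)
    then have "L d n differentiable at (cell_boundary xb j d i)" if "n \<le> 5" for n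
      using that by (intro lagrange_functions_differentiable[OF dual, of "lam d"]) (auto simp: A_def)
    with elim show ?case
      unfolding w_def assms(6) by (intro allI impI lagrange_derivative_moments) auto
  qed
  have w_lim: "(\<lambda>d. w d n - a n 1) \<in> O[at_right 0](\<lambda>d. d ^ 2)" if "n \<le> 5" for n
  proof (rule bigoI)
    show "\<forall>\<^sub>F d in at_right 0. norm (w d n - a n 1) \<le> (4 * \<Lambda> * A * (\<Sum>m\<le>5. \<bar>a m 1\<bar>)) * norm (d ^ 2)"
      using ev moments
    proof eventually_elim
      case (elim d)
      then have "\<bar>w d n - a n 1\<bar> \<le> 4 * norm (lam d) ^ 2 * d ^ 2 * A * (\<Sum>m\<le>5. \<bar>a m 1\<bar>)"
        unfolding A_def using that
        by (intro moment_weights_near_polynomial_weights[OF dual]) (auto simp: A_def)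
      also have "\<dots> \<le> 4 * \<Lambda> * d ^ 2 * A * (\<Sum>m\<le>5. \<bar>a m 1\<bar>)"
        using elim \<open>A \<ge> 0\<close> by (intro mult_right_mono mult_left_mono) (auto intro: sum_nonneg)
      finally show ?case by (simp add: mult_ac)
    qed
  qed
  have d2_1: "(\<lambda>d::real. d ^ 2) \<in> O[at_right 0](\<lambda>_. 1)"
    using bigo_power_mono_at_right_0[of 0 2] by simp
  have w_1: "(\<lambda>d. w d n) \<in> O[at_right 0](\<lambda>_. 1)" if "n \<le> 5" for n
  proof -
    have "(\<lambda>d. (w d n - a n 1) + a n 1) \<in> O[at_right 0](\<lambda>_. 1)"
      using landau_o.big.trans[OF w_lim[OF that] d2_1] by (intro sum_in_bigo(1)) auto
    then show ?thesis by (simp only: diff_add_cancel)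
  qed
  have S_lim: "(\<lambda>d. S d m - \<sigma> m) \<in> O[at_right 0](\<lambda>d. d ^ 2)" for m
  proof -
    have "(\<lambda>d. \<Sum>n\<le>5. (k n ^ m / fact m) * (w d n - a n 1)) \<in> O[at_right 0](\<lambda>d. d ^ 2)"
      using w_lim by (intro big_sum_in_bigo) (auto intro: landau_o.big.mult_in_1)
    moreover have "(\<Sum>n\<le>5. (k n ^ m / fact m) * (w d n - a n 1)) = S d m - \<sigma> m" for d
      unfolding S_def \<sigma>_def sum_subtractf[symmetric] by (intro sum.cong refl) algebra
    ultimately show ?thesis by simp
  qed
  have S_1: "(\<lambda>d. S d m) \<in> O[at_right 0](\<lambda>_. 1)" for m
  proof -
    have "(\<lambda>d. (S d m - \<sigma> m) + \<sigma> m) \<in> O[at_right 0](\<lambda>_. 1)"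
      using landau_o.big.trans[OF S_lim d2_1] by (intro sum_in_bigo(1)) auto
    then show ?thesis by (simp only: diff_add_cancel)
  qed

  \<comment> \<open>The moments of order 4 and 5\<close>
  define T where "T d l = S d l + \<mu> d * d ^ 2 * S d (l + 2)" for d l
  have T: "(\<lambda>d. T d l) \<in> O[at_right 0](\<lambda>d. d ^ 4)" if l: "l = 4 \<or> l = 5" for l
  proof -
    define \<rho> where "\<rho> d n = scaled_basis (lam d) d l n - k n ^ l / fact l
      - \<mu> d * d ^ 2 * k n ^ (l + 2) / fact (l + 2)" for d n
    have \<rho>: "(\<lambda>d. \<rho> d n) \<in> O[at_right 0](\<lambda>d. d ^ 4)" if "n \<le> 5" for n
    proof (rule bigoI)
      show "\<forall>\<^sub>F d in at_right 0. norm (\<rho> d n) \<le> (4 * \<Lambda> ^ 2) * norm (d ^ 4)"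
        using ev
      proof eventually_elim
        case (elim d)
        then have "\<bar>\<rho> d n\<bar> \<le> 4 * norm (lam d) ^ 4 * d ^ 4"
          unfolding \<rho>_def k_def \<mu>_def using l that by (intro scaled_basis_expansion) auto
        also have "\<dots> = 4 * (norm (lam d) ^ 2) ^ 2 * d ^ 4" by simp
        also have "\<dots> \<le> 4 * \<Lambda> ^ 2 * d ^ 4"
          using elim by (intro mult_right_mono mult_left_mono power_mono) auto
        finally show ?case by simp
      qed
    qed
    have "(\<lambda>d. \<Sum>n\<le>5. - (w d n * \<rho> d n)) \<in> O[at_right 0](\<lambda>d. d ^ 4)"
    proof (rule big_sum_in_bigo)
      fix n :: nat assume "n \<in> {..5}"
      then have "(\<lambda>d. w d n * \<rho> d n) \<in> O[at_right 0](\<lambda>d. 1 * d ^ 4)"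
        using w_1 \<rho> by (intro landau_o.big.mult) auto
      then show "(\<lambda>d. - (w d n * \<rho> d n)) \<in> O[at_right 0](\<lambda>d. d ^ 4)" by simp
    qed
    \<comment> \<open>The exact row \<open>l\<close> equals 0 and splits into \<open>T d l\<close>
      plus the weighted remainders.\<close>
    moreover have "\<forall>\<^sub>F d in at_right 0. (\<Sum>n\<le>5. - (w d n * \<rho> d n)) = T d l"
      using moments
    proof eventually_elim
      case (elim d)
      have "(\<Sum>n\<le>5. w d n * scaled_basis (lam d) d l n) = 0"
        using elim l by auto
      moreover have "(\<Sum>n\<le>5. w d n * \<rho> d n) = (\<Sum>n\<le>5. w d n * scaled_basis (lam d) d l n) - T d l"
        unfolding T_def S_def \<rho>_def sum_distrib_left sum.distrib[symmetric] sum_subtractf[symmetric]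
        by (intro sum.cong refl) (simp add: algebra_simps)
      ultimately show ?case by (simp add: sum_negf)
    qed
    ultimately show ?thesis by (simp add: landau_o.big.in_cong)
  qed

  \<comment> \<open>Taylor remainders on the stencil\<close>
  define D where "D = nth_deriv 7 H xb"
  define R where "R d n = H (X d i + k n * d) - (\<Sum>m<7. nth_deriv m H (X d i) / fact m * (k n * d) ^ m)
      - D / fact 7 * (k n * d) ^ 7" for d n
  \<comment> \<open>The remainder is O(d^8); one power is lost because the flux uses
    \<open>w d n / d\<close>.\<close>
  have R: "(\<lambda>d. R d n / d) \<in> O[at_right 0](\<lambda>d. d ^ 7)" if "n \<le> 5" for n
  proof (rule bigoI)
    have kn: "\<bar>k n\<bar> \<le> 3" using that by (auto simp: k_def)
    show "\<forall>\<^sub>F d in at_right 0. norm (R d n / d) \<le> (C * 4 * 3 ^ 7) * norm (d ^ 7)"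
      using ev
    proof eventually_elim
      case (elim d)
      have kd: "\<bar>k n * d\<bar> \<le> 3 * d" and ed: "\<bar>e * d\<bar> \<le> d"
        using elim kn e by (auto simp: abs_mult)
      have "\<bar>H (X d i + k n * d) - (\<Sum>m<7. nth_deriv m H (X d i) / fact m * (X d i + k n * d - X d i) ^ m)
          - nth_deriv 7 H xb / fact 7 * (X d i + k n * d - X d i) ^ 7\<bar>
          \<le> C * (4 * d) * \<bar>X d i + k n * d - X d i\<bar> ^ 7"
      proof (rule taylor_remainder_lipschitz)
        fix m x assume "m < (7::nat)" "\<bar>x - xb\<bar> \<le> 4 * d"
        then show "(nth_deriv m H has_real_derivative nth_deriv (Suc m) H x) (at x)"
          using dH near elim by auto
      qed (use kd ed elim lip \<open>C > 0\<close> in \<open>auto simp: Xi\<close>)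
      also have "X d i + k n * d - X d i = k n * d" by simp
      finally have "\<bar>R d n\<bar> \<le> C * (4 * d) * \<bar>k n * d\<bar> ^ 7"
        by (simp add: R_def D_def)
      also have "\<dots> \<le> C * (4 * d) * (3 * d) ^ 7"
        using elim \<open>C > 0\<close> kd by (intro mult_left_mono power_mono) auto
      finally have "\<bar>R d n\<bar> / d \<le> C * (4 * d) * (3 * d) ^ 7 / d"
        using elim by (intro divide_right_mono) auto
      then show ?case using elim by (simp add: power_mult_distrib)
    qed
  qed
  have Rw: "(\<lambda>d. \<Sum>n\<le>5. w d n * (R d n / d)) \<in> O[at_right 0](\<lambda>d. d ^ 7)"
  proof (rule big_sum_in_bigo)
    fix n :: nat assume "n \<in> {..5}"
    then have "(\<lambda>d. w d n * (R d n / d)) \<in> O[at_right 0](\<lambda>d. 1 * d ^ 7)"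
      using w_1 R by (intro landau_o.big.mult) auto
    then show "(\<lambda>d. w d n * (R d n / d)) \<in> O[at_right 0](\<lambda>d. d ^ 7)" by simp
  qed

  \<comment> \<open>The coefficient of d^6 and its value at the cell center\<close>
  define p where "p x = nth_deriv 5 H x * q x" for x
  have diffp: "p differentiable at xb"
    unfolding p_def using diffq diffH by (intro differentiable_mult) auto
  have H1: "(\<lambda>d. nth_deriv m H (X d i)) \<in> O[at_right 0](\<lambda>_. 1)" if "m < 7" for m
    unfolding Xi by (rule differentiable_imp_bigo_1[OF diffH[OF that]])
  have K: "leading_const H u x = (p x - nth_deriv 7 H x) * \<sigma> 7" for x
    by (simp add: leading_const_def p_def q_def \<sigma>_def k_def flip: a1)

  \<comment> \<open>A telescoped form of \<open>(\<mu> d * H5 - D) * S d 7\<close> minus the leading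
    constant, with H5 the fifth derivative at \<open>X d i\<close>. Each summand replaces one
    quantity by its limit or moves an evaluation point, at a cost of O(d).\<close>
  define B where "B d = S d 7 * nth_deriv 5 H (X d i) * (\<mu> d - q (X d i))
      + (S d 7 - \<sigma> 7) * (p (X d i) - D)
      + \<sigma> 7 * ((p (X d i) - p xb) - (p (cell_center (X d) j) - p xb))
      + \<sigma> 7 * (nth_deriv 7 H (cell_center (X d) j) - D)" for d
  have d2_d: "(\<lambda>d::real. d ^ 2) \<in> O[at_right 0](\<lambda>d. d)"
    using bigo_power_mono_at_right_0[of 1 2] by simp
  have B: "B \<in> O[at_right 0](\<lambda>d. d)"
  proof -
    have "(\<lambda>d. S d 7 * nth_deriv 5 H (X d i) * (\<mu> d - q (X d i))) \<in> O[at_right 0](\<lambda>d. 1 * 1 * d)"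
      using landau_o.big.trans[OF \<mu> d2_d] by (intro landau_o.big.mult S_1 H1) auto
    moreover have "(\<lambda>d. (S d 7 - \<sigma> 7) * (p (X d i) - D)) \<in> O[at_right 0](\<lambda>d. d * 1)"
      unfolding Xi
      by (intro landau_o.big.mult landau_o.big.trans[OF S_lim d2_d]
          sum_in_bigo(2)[OF differentiable_imp_bigo_1[OF diffp]]) auto
    moreover have "(\<lambda>d. \<sigma> 7 * ((p (X d i) - p xb) - (p (cell_center (X d) j) - p xb)))
        \<in> O[at_right 0](\<lambda>d. 1 * d)"
      unfolding Xi Xj
      by (intro landau_o.big.mult sum_in_bigo(2)[OF differentiable_imp_bigo_increment[OF diffp] differentiable_imp_bigo_increment[OF diffp]]) auto
    moreover have "(\<lambda>d. nth_deriv 7 H (cell_center (X d) j) - D) \<in> O[at_right 0](\<lambda>d. d)"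
    proof (rule bigoI)
      show "\<forall>\<^sub>F d in at_right 0. norm (nth_deriv 7 H (cell_center (X d) j) - D) \<le> C * norm d"
        using ev
      proof eventually_elim
        case (elim d)
        then have "\<bar>nth_deriv 7 H (cell_center (X d) j) - D\<bar> \<le> C * (d / 2)"
          unfolding D_def Xj using lip[of "xb + (-1/2) * d"] by simp
        also have "\<dots> \<le> C * d"
          using elim \<open>C > 0\<close> by simp
        finally show ?case using elim by simp
      qed
    qed
    then have "(\<lambda>d. \<sigma> 7 * (nth_deriv 7 H (cell_center (X d) j) - D)) \<in> O[at_right 0](\<lambda>d. 1 * d)"
      by (intro landau_o.big.mult) auto
    ultimately show ?thesis
      unfolding B_def by (intro sum_in_bigo) simp_all
  qed

  \<comment> \<open>Collecting the error terms\<close>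
  define G where "G d = - (\<Sum>n\<le>5. w d n * (R d n / d))
      - d ^ 3 * (nth_deriv 4 H (X d i) * T d 4) - d ^ 4 * (nth_deriv 5 H (X d i) * T d 5)
      + d ^ 5 * (S d 6 * (nth_deriv 4 H (X d i) * (\<mu> d - q (X d i)))) + d ^ 6 * B d" for d
  have "G \<in> O[at_right 0](\<lambda>d. d ^ 7)"
  proof -
    have "(\<lambda>d. d ^ 3 * (nth_deriv 4 H (X d i) * T d 4)) \<in> O[at_right 0](\<lambda>d. d ^ 3 * (1 * d ^ 4))"
      by (intro landau_o.big.mult H1 T) auto
    \<comment> \<open>This term is even O(d^8); one factor \<open>d\<close> is given away to match
      the others.\<close>
    moreover have "(\<lambda>d. d ^ 4 * (nth_deriv 5 H (X d i) * T d 5)) \<in> O[at_right 0](\<lambda>d. d ^ 3 * (1 * d ^ 4))"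
      by (intro landau_o.big.mult H1 T bigo_power_mono_at_right_0) auto
    moreover have "(\<lambda>d. d ^ 5 * (S d 6 * (nth_deriv 4 H (X d i) * (\<mu> d - q (X d i)))))
        \<in> O[at_right 0](\<lambda>d. d ^ 5 * (1 * (1 * d ^ 2)))"
      by (intro landau_o.big.mult H1 S_1 \<mu>) auto
    moreover have "(\<lambda>d. d ^ 6 * B d) \<in> O[at_right 0](\<lambda>d. d ^ 6 * d)"
      by (intro landau_o.big.mult B) auto
    moreover have "(\<lambda>d. - (\<Sum>n\<le>5. w d n * (R d n / d))) \<in> O[at_right 0](\<lambda>d. d ^ 7)"
      using Rw by simp
    moreover have "(d::real) ^ 3 * (1 * d ^ 4) = d ^ 7" "d ^ 5 * (1 * (1 * d ^ 2)) = d ^ 7"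
      "d ^ 6 * d = d ^ 7" for d
      by algebra+
    ultimately show ?thesis
      unfolding G_def by (intro sum_in_bigo) simp_all
  qed
  moreover have "\<forall>\<^sub>F d in at_right 0. G d = h (X d i) - num_flux (L d) (X d) i H
                - leading_const H u (cell_center (X d) j) * d ^ 6"
  proof -
    \<comment> \<open>Division by zero yields 0, so recovering the sixth derivative as the fourth
      times \<open>q\<close> at \<open>X d i\<close> requires the fourth to be nonzero there, which
      holds for small \<open>d\<close> by continuity.\<close>
    have "((\<lambda>d. xb + e * d) \<longlongrightarrow> xb + e * 0) (at_right 0)"
      by (intro tendsto_intros)
    then have "((\<lambda>d. nth_deriv 4 H (xb + e * d)) \<longlongrightarrow> nth_deriv 4 H xb) (at_right 0)"
      by (intro isCont_tendsto_compose[OF DERIV_isCont[OF dH[of 4 xb]]]) (use assms(2) in simp_all)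
    then have "\<forall>\<^sub>F d in at_right 0. nth_deriv 4 H (X d i) \<noteq> 0"
      unfolding Xi using assms(8) by (rule tendsto_imp_eventually_ne)
    then show ?thesis
      using ev moments
    proof eventually_elim
      case (elim d)
      let ?H = "\<lambda>m. nth_deriv m H (X d i)"
      have "d > 0" using elim by simp
      have low: "S d l = (if l = 1 then 1 else 0)" if "l \<le> 3" for l
      proof -
        have "S d l = (\<Sum>n\<le>5. w d n * scaled_basis (lam d) d l n)"
          unfolding S_def k_def by (simp only: scaled_basis_le_3[OF that \<open>d > 0\<close>])
        then show ?thesis using elim(3) that by simp
      qed
      have "\<bar>X d i - xb\<bar> < r"
      proof -
        have "\<bar>X d i - xb\<bar> = \<bar>e\<bar> * d" using \<open>d > 0\<close> by (simp add: Xi abs_mult)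
        also have "\<dots> \<le> 1 * d" using e \<open>d > 0\<close> by (intro mult_right_mono) auto
        finally show ?thesis using elim(2) by linarith
      qed
      then have hX: "h (X d i) = ?H 1"
        using DERIV_unique[OF assms(5), of "X d i" "?H 1"] dH[of 0 "X d i"] near by simp
      have "d * num_flux (L d) (X d) i H = (\<Sum>n\<le>5. w d n * H (X d i + k n * d))"
        by (simp add: num_flux_def w_def Xn k_def sum_distrib_left mult.assoc)
      also have "\<dots> = (\<Sum>n\<le>5. w d n * ((\<Sum>m<7. ?H m / fact m * (k n * d) ^ m)
          + D / fact 7 * (k n * d) ^ 7 + R d n))"
        by (simp add: R_def)
      also have "\<dots> = (\<Sum>m<7. ?H m * d ^ m * S d m) + D * d ^ 7 * S d 7 + (\<Sum>n\<le>5. w d n * R d n)"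
        unfolding S_def by (rule weighted_sum_taylor)
      \<comment> \<open>Exactness on cubic polynomials leaves the first moment 1 and removes those
        of order 0, 2 and 3.\<close>
      also have "(\<Sum>m<7. ?H m * d ^ m * S d m)
          = ?H 1 * d + ?H 4 * d ^ 4 * S d 4 + ?H 5 * d ^ 5 * S d 5 + ?H 6 * d ^ 6 * S d 6"
        using low[of 0] low[of 1] low[of 2] low[of 3]
        by (simp add: lessThan_nat_numeral lessThan_Suc numeral_eq_Suc)
      also have "(\<Sum>n\<le>5. w d n * R d n) = d * (\<Sum>n\<le>5. w d n * (R d n / d))"
        using \<open>d > 0\<close> by (simp add: sum_distrib_left)
      finally have "d * num_flux (L d) (X d) i H = d * (?H 1 + ?H 4 * d ^ 3 * S d 4
          + ?H 5 * d ^ 4 * S d 5 + ?H 6 * d ^ 5 * S d 6 + D * d ^ 6 * S d 7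
          + (\<Sum>n\<le>5. w d n * (R d n / d)))"
        by algebra
      then have flux: "num_flux (L d) (X d) i H = ?H 1 + ?H 4 * d ^ 3 * S d 4
          + ?H 5 * d ^ 4 * S d 5 + ?H 6 * d ^ 5 * S d 6 + D * d ^ 6 * S d 7
          + (\<Sum>n\<le>5. w d n * (R d n / d))"
        using \<open>d > 0\<close> by simp
      have H6: "?H 6 = ?H 4 * q (X d i)"
        using elim by (simp add: q_def)
      have pX: "p (X d i) = ?H 5 * q (X d i)" by (simp add: p_def)
      have T45: "T d 4 = S d 4 + \<mu> d * d ^ 2 * S d 6" "T d 5 = S d 5 + \<mu> d * d ^ 2 * S d 7"
        by (simp_all add: T_def)
      show ?case
        unfolding hX flux K G_def B_def T45 H6 pX by algebra
    qed
  qed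
  ultimately show ?thesis
    by (simp add: landau_o.big.in_cong)
qed

end
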